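(* Let $n\geq r\geq 3$ and $t\geq 3$ be integers. Then \[ {\rm spex}^{\rm lin}_r(n,\text{Berge-}K_{3,t})\leq f^{1/2}\Big(n,r,t,\tfrac{n-1}{r-1},\tfrac{n-1}{r-1}\Big), \] where for real $x,y$, \[ f(n,r,t,x,y)=\Big(t(r-1)+\frac{(r-2)(n-r)}{2(r-1)}+\frac{n-r}{(r-1)^2}\Big)x+\frac{1}{r-1}y-\Big(t+r-2+\frac{(r-2)(n-r-2)}{2(r-1)}-\frac{(r-2)(r-3)(n-r)}{2(r-1)^2}\Big). \]
   Context: An $r$-graph ($r$-uniform hypergraph) $H$ has edges that are $r$-element subsets of $V(H)$; it is linear if any two distinct edges share at most one vertex. For a simple graph $F$, $H$ is a Berge-$F$ if there is a bijection $\phi:E(F)\to E(H)$ with $e\subseteq\phi(e)$ for all $e\in E(F)$; $H$ is Berge-$F$-free if no sub-hypergraph (subset of its edges) is a Berge-$F$. $K_{3,t}$ is the complete bipartite graph with parts of sizes $3$ and $t$. For an $r$-graph $H$ on vertex set $[n]$, its adjacency tensor $\mathcal{A}(H)$ is the order-$r$, dimension-$n$ symmetric tensor with $\mathcal{A}_{i_1\cdots i_r}=\frac{1}{(r-1)!}$ if $\{i_1,\dots,i_r\}\in E(H)$ and $0$ otherwise. For a tensor $\mathcal{T}$ and $\mathbf{x}\in\mathbb{C}^n$, $(\mathcal{T}\mathbf{x}^{r-1})_i=\sum_{i_2,\dots,i_r\in[n]}\mathcal{T}_{ii_2\cdots i_r}x_{i_2}\cdots x_{i_r}$; $\lambda\in\mathbb{C}$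 is an eigenvalue if $\mathcal{T}\mathbf{x}^{r-1}=\lambda\mathbf{x}^{[r-1]}$ for some nonzero $\mathbf{x}$, where $\mathbf{x}^{[r-1]}=(x_1^{r-1},\dots,x_n^{r-1})^{T}$. The spectral radius $\rho(H)$ is the maximum modulus of an eigenvalue of $\mathcal{A}(H)$. ${\rm spex}^{\rm lin}_r(n,\text{Berge-}K_{3,t})$ is the maximum of $\rho(H)$ over all connected Berge-$K_{3,t}$-free linear $r$-graphs $H$ on $n$ vertices. *)

theory Defs
  imports "HOL-Analysis.Analysis"
begin

section \<open>Hypergraphs\<close>

text \<open>A hypergraph on the vertex set \<open>[n] = {1..n}\<close> is given by \<open>n\<close> and its set of edges.\<close>

definition uniform_hypergraph :: "nat \<Rightarrow> nat \<Rightarrow> nat set set \<Rightarrow> bool" where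
  "uniform_hypergraph n r E \<longleftrightarrow> (\<forall>e\<in>E. e \<subseteq> {1..n} \<and> card e = r)"

definition linear_hypergraph :: "'a set set \<Rightarrow> bool" where
  "linear_hypergraph E \<longleftrightarrow> (\<forall>e\<in>E. \<forall>e'\<in>E. e \<noteq> e' \<longrightarrow> card (e \<inter> e') \<le> 1)"

definition connected_hypergraph :: "nat \<Rightarrow> nat set set \<Rightarrow> bool" where
  "connected_hypergraph n E \<longleftrightarrow>
     (\<forall>u\<in>{1..n}. \<forall>v\<in>{1..n}. (u, v) \<in> {(a, b). \<exists>e\<in>E. a \<in> e \<and> b \<in> e}\<^sup>*)"

text \<open>
  A simple graph without isolated vertices is given by its set \<open>F\<close> of two-element edges, so that
  its vertex set is \<open>\<Union>F\<close>.  The hypergraph is a Berge-\<open>F\<close> when some copy of \<open>F\<close> (the image under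
  the injection \<open>g\<close>) on its vertices admits the required bijection between edges.
\<close>

definition is_Berge :: "'b set set \<Rightarrow> 'a set set \<Rightarrow> bool" where
  "is_Berge F E \<longleftrightarrow>
     (\<exists>g \<phi>. inj_on g (\<Union>F) \<and> bij_betw \<phi> F E \<and> (\<forall>e\<in>F. g ` e \<subseteq> \<phi> e))"

definition Berge_free :: "'b set set \<Rightarrow> 'a set set \<Rightarrow> bool" where
  "Berge_free F E \<longleftrightarrow> (\<forall>E'\<subseteq>E. \<not> is_Berge F E')"

definition complete_bipartite :: "nat \<Rightarrow> nat \<Rightarrow> (nat + nat) set set" where
  "complete_bipartite s t = {{Inl i, Inr j} | i j. i < s \<and> j < t}"


section \<open>Tensors and their eigenvalues\<close>

text \<open>
  A tensor of order \<open>r\<close> and dimension \<open>n\<close> is a function on index lists, of which only the values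
  at lists of length \<open>r\<close> with entries in \<open>{1..n}\<close> matter.  Likewise only the entries of a vector
  \<open>x\<close> with index in \<open>{1..n}\<close> matter.
\<close>

definition tensor_apply ::
    "nat \<Rightarrow> nat \<Rightarrow> (nat list \<Rightarrow> complex) \<Rightarrow> (nat \<Rightarrow> complex) \<Rightarrow> nat \<Rightarrow> complex" where
  "tensor_apply n r T x i =
     (\<Sum>js | length js = r - 1 \<and> set js \<subseteq> {1..n}. T (i # js) * prod_list (map x js))"

definition tensor_eigenvalue :: "nat \<Rightarrow> nat \<Rightarrow> (nat list \<Rightarrow> complex) \<Rightarrow> complex \<Rightarrow> bool" where
  "tensor_eigenvalue n r T \<mu> \<longleftrightarrow>
     (\<exists>x. (\<exists>i\<in>{1..n}. x i \<noteq> 0) \<and> (\<forall>i\<in>{1..n}. tensor_apply n r T x i = \<mu> * x i ^ (r - 1)))"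

text \<open>
  If \<open>r\<close> is the length of the list and all edges have cardinality \<open>r\<close>, then \<open>set is \<in> E\<close> forces the
  indices to be distinct.
\<close>

definition adjacency_tensor :: "nat \<Rightarrow> nat set set \<Rightarrow> nat list \<Rightarrow> complex" where
  "adjacency_tensor r E is = (if length is = r \<and> set is \<in> E then 1 / fact (r - 1) else 0)"

text \<open>
  The supremum below is a maximum: see \<open>tensor_eigenvalue_max\<close> and \<open>spectral_radius_max\<close>.
\<close>

definition spectral_radius :: "nat \<Rightarrow> nat \<Rightarrow> nat set set \<Rightarrow> real" where
  "spectral_radius n r E = Sup {cmod \<mu> | \<mu>. tensor_eigenvalue n r (adjacency_tensor r E) \<mu>}"

lemma finite_index_lists: "finite {js. length js = k \<and> set js \<subseteq> {1..n::nat}}"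
  using finite_lists_length_eq[of "{1..n}" k] by (simp add: conj_commute)

lemma tensor_apply_scale:
  "tensor_apply n r T (\<lambda>i. c * x i) i = c ^ (r - 1) * tensor_apply n r T x i"
proof -
  have "prod_list (map (\<lambda>i. c * x i) js) = c ^ length js * prod_list (map x js)" for js
    by (induction js) (auto simp: algebra_simps)
  then show ?thesis
    unfolding tensor_apply_def sum_distrib_left by (intro sum.cong) auto
qed

lemma tensor_eigenvalue_normalized:
  assumes "tensor_eigenvalue n r T \<mu>"
  obtains x where "\<And>i. cmod (x i) \<le> 1" "\<exists>i\<in>{1..n}. cmod (x i) = 1"
    "\<And>i. i \<in> {1..n} \<Longrightarrow> tensor_apply n r T x i = \<mu> * x i ^ (r - 1)"
proof -
  obtain x k where k: "k \<in> {1..n}" "x k \<noteq> 0"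
    and eq: "\<And>i. i \<in> {1..n} \<Longrightarrow> tensor_apply n r T x i = \<mu> * x i ^ (r - 1)"
    using assms unfolding tensor_eigenvalue_def by blast
  define m where "m = Max ((\<lambda>i. cmod (x i)) ` {1..n})"
  have ub: "cmod (x i) \<le> m" if "i \<in> {1..n}" for i
    unfolding m_def using that by (intro Max_ge) auto
  have "m \<in> (\<lambda>i. cmod (x i)) ` {1..n}"
    unfolding m_def using k by (intro Max_in) auto
  then obtain l where l: "l \<in> {1..n}" "cmod (x l) = m" by auto
  have m0: "m > 0" using ub[OF k(1)] k(2) by (meson less_le_trans zero_less_norm_iff)
  define c where "c = inverse (complex_of_real m)"
  define y where "y i = (if i \<in> {1..n} then c * x i else 0)" for i
  have app: "tensor_apply n r T y i = tensor_apply n r T (\<lambda>i. c * x i) i" for i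
    unfolding tensor_apply_def
    by (intro sum.cong refl arg_cong2[of _ _ _ _ "(*)"] arg_cong[of _ _ prod_list] map_cong)
       (auto simp: y_def)
  show ?thesis
  proof (rule that)
    show "cmod (y i) \<le> 1" for i
      using ub[of i] m0 by (auto simp: y_def c_def norm_mult norm_inverse norm_divide field_simps)
    show "\<exists>i\<in>{1..n}. cmod (y i) = 1"
      using l m0 by (intro bexI[of _ l]) (auto simp: y_def c_def norm_mult norm_inverse)
    show "tensor_apply n r T y i = \<mu> * y i ^ (r - 1)" if "i \<in> {1..n}" for i
      using that eq[OF that]
      by (simp add: app tensor_apply_scale y_def power_mult_distrib)
  qed
qed

lemma cmod_prod_list_le_1:
  assumes "\<And>i. cmod (x i) \<le> 1"
  shows "cmod (prod_list (map x js)) \<le> 1"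
  by (induction js) (auto simp: norm_mult assms mult_le_one)

lemma tensor_eigenvalue_bounded:
  obtains B where "\<And>\<mu>. tensor_eigenvalue n r T \<mu> \<Longrightarrow> cmod \<mu> \<le> B"
proof
  let ?J = "{js. length js = r - 1 \<and> set js \<subseteq> {1..n}}"
  let ?S = "\<lambda>i. \<Sum>js\<in>?J. cmod (T (i # js))"
  show "cmod \<mu> \<le> (\<Sum>i\<in>{1..n}. ?S i)" if ev: "tensor_eigenvalue n r T \<mu>" for \<mu>
  proof -
    obtain x where x: "\<And>i. cmod (x i) \<le> 1" "\<exists>i\<in>{1..n}. cmod (x i) = 1"
      "\<And>i. i \<in> {1..n} \<Longrightarrow> tensor_apply n r T x i = \<mu> * x i ^ (r - 1)"
      using tensor_eigenvalue_normalized[OF ev] by blast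
    then obtain i where i: "i \<in> {1..n}" "cmod (x i) = 1" by blast
    have "cmod \<mu> = cmod (tensor_apply n r T x i)"
      using x(3)[OF i(1)] i(2) by (simp add: norm_mult norm_power)
    also have "\<dots> \<le> ?S i"
      unfolding tensor_apply_def
      by (rule sum_norm_le) (auto simp: norm_mult intro!: mult_left_le cmod_prod_list_le_1 x(1))
    also have "\<dots> \<le> (\<Sum>i\<in>{1..n}. ?S i)"
      using i(1) by (intro member_le_sum) (auto intro: sum_nonneg)
    finally show ?thesis .
  qed
qed

lemma continuous_on_coord: "continuous_on S (\<lambda>p :: complex \<times> (nat \<Rightarrow> complex). snd p i)"
proof -
  have "continuous_on (snd ` S) (\<lambda>x :: nat \<Rightarrow> complex. x i)"
    by (rule continuous_on_subset[OF continuous_on_product_coordinates]) auto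
  then have "continuous_on S ((\<lambda>x. x i) \<circ> snd)"
    by (intro continuous_on_compose continuous_on_snd continuous_on_id) auto
  then show ?thesis by (simp add: o_def)
qed

lemma compact_unit_polydisc: "compact {x :: nat \<Rightarrow> complex. \<forall>i. cmod (x i) \<le> 1}"
proof -
  have "compactin (product_topology (\<lambda>_::nat. euclidean :: complex topology) UNIV)
          (PiE UNIV (\<lambda>_. cball 0 1))"
    by (subst compactin_PiE) auto
  moreover have "PiE UNIV (\<lambda>_::nat. cball (0::complex) 1) = {x. \<forall>i. cmod (x i) \<le> 1}"
    by (auto simp: PiE_def Pi_def)
  ultimately show ?thesis
    by (simp add: euclidean_product_topology)
qed

lemma tensor_eigenvalue_max:
  assumes "tensor_eigenvalue n r T \<nu>"
  shows "\<exists>\<mu>. tensor_eigenvalue n r T \<mu> \<and> (\<forall>\<mu>'. tensor_eigenvalue n r T \<mu>' \<longrightarrow> cmod \<mu>' \<le> cmod \<mu>)"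
proof -
  obtain B where B: "\<And>\<mu>. tensor_eigenvalue n r T \<mu> \<Longrightarrow> cmod \<mu> \<le> B"
    using tensor_eigenvalue_bounded by blast
  let ?P = "cball (0::complex) B \<times> {x :: nat \<Rightarrow> complex. \<forall>i. cmod (x i) \<le> 1}"
  define C where "C = (\<Inter>i\<in>{1..n}. {p. tensor_apply n r T (snd p) i = fst p * snd p i ^ (r - 1)})
      \<inter> (\<Union>i\<in>{1..n}. {p :: complex \<times> (nat \<Rightarrow> complex). cmod (snd p i) = 1})"
  have prodlist: "continuous_on UNIV (\<lambda>p :: complex \<times> (nat \<Rightarrow> complex). prod_list (map (snd p) js))" for js
    by (induction js) (auto intro!: continuous_intros continuous_on_coord)
  have "closed C"
    unfolding C_def tensor_apply_def
    by (intro closed_Int closed_INT closed_UN ballI finite_atLeastAtMost closed_Collect_eq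
        continuous_on_sum continuous_on_mult continuous_on_const prodlist continuous_on_fst
        continuous_on_id continuous_on_power continuous_on_coord continuous_on_norm)
  then have K: "compact (?P \<inter> C)"
    by (intro compact_Int_closed compact_Times compact_cball compact_unit_polydisc)
  have img: "\<exists>p\<in>?P \<inter> C. fst p = \<mu>" if ev: "tensor_eigenvalue n r T \<mu>" for \<mu>
  proof -
    obtain x where "\<And>i. cmod (x i) \<le> 1" "\<exists>i\<in>{1..n}. cmod (x i) = 1"
      "\<And>i. i \<in> {1..n} \<Longrightarrow> tensor_apply n r T x i = \<mu> * x i ^ (r - 1)"
      using tensor_eigenvalue_normalized[OF ev] by blast
    with B[OF ev] show ?thesis by (intro bexI[of _ "(\<mu>, x)"]) (auto simp: C_def)
  qed
  have ev: "tensor_eigenvalue n r T (fst p)" if p: "p \<in> ?P \<inter> C" for p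
  proof -
    obtain i where "i \<in> {1..n}" "cmod (snd p i) = 1" using p by (auto simp: C_def)
    then have "\<exists>i\<in>{1..n}. snd p i \<noteq> 0" by (intro bexI[of _ i]) auto
    moreover have "tensor_apply n r T (snd p) i = fst p * snd p i ^ (r - 1)"
      if "i \<in> {1..n}" for i
      using p that by (simp add: C_def)
    ultimately show ?thesis unfolding tensor_eigenvalue_def by blast
  qed
  have "\<exists>p\<in>?P \<inter> C. \<forall>q\<in>?P \<inter> C. cmod (fst q) \<le> cmod (fst p)"
    using img[OF assms]
    by (intro continuous_attains_sup K continuous_on_norm continuous_on_fst continuous_on_id) auto
  then show ?thesis using img ev by metis
qed

lemma adjacency_tensor_eigenvalue_0:
  assumes "r \<ge> 3" "n \<ge> 1" "uniform_hypergraph n r E"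
  shows "tensor_eigenvalue n r (adjacency_tensor r E) 0"
  unfolding tensor_eigenvalue_def
proof (intro exI conjI ballI)
  let ?x = "\<lambda>i::nat. if i = 1 then 1 else 0 :: complex"
  show "\<exists>i\<in>{1..n}. ?x i \<noteq> 0" using assms by (intro bexI[of _ 1]) auto
  have "adjacency_tensor r E (i # js) * prod_list (map ?x js) = 0"
    if "length js = r - 1" for i js
  proof (cases "set js \<subseteq> {1}")
    case True
    have "card (set (i # js)) \<le> card {i, 1}" using True by (intro card_mono) auto
    also have "\<dots> \<le> 2" by (cases "i = 1") auto
    finally have "set (i # js) \<notin> E" using assms by (auto simp: uniform_hypergraph_def)
    then show ?thesis by (simp add: adjacency_tensor_def)
  next
    case False
    then have "prod_list (map ?x js) = 0" by (auto simp: prod_list_zero_iff)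
    then show ?thesis by simp
  qed
  then show "tensor_apply n r (adjacency_tensor r E) ?x i = 0 * ?x i ^ (r - 1)" for i
    unfolding tensor_apply_def by (simp add: sum.neutral)
qed

lemma spectral_radius_max:
  assumes "r \<ge> 3" "n \<ge> 1" "uniform_hypergraph n r E"
  shows "\<exists>\<mu>. tensor_eigenvalue n r (adjacency_tensor r E) \<mu> \<and> cmod \<mu> = spectral_radius n r E"
    and "\<And>\<mu>. tensor_eigenvalue n r (adjacency_tensor r E) \<mu> \<Longrightarrow> cmod \<mu> \<le> spectral_radius n r E"
proof -
  let ?ev = "tensor_eigenvalue n r (adjacency_tensor r E)"
  obtain \<mu> where l: "?ev \<mu>" "\<And>\<mu>'. ?ev \<mu>' \<Longrightarrow> cmod \<mu>' \<le> cmod \<mu>"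
    using tensor_eigenvalue_max[OF adjacency_tensor_eigenvalue_0[OF assms]] by blast
  then have "spectral_radius n r E = cmod \<mu>"
    unfolding spectral_radius_def by (intro cSup_eq_maximum) auto
  with l show "\<exists>\<mu>. ?ev \<mu> \<and> cmod \<mu> = spectral_radius n r E"
    and "\<And>\<mu>. ?ev \<mu> \<Longrightarrow> cmod \<mu> \<le> spectral_radius n r E" by auto
qed


section \<open>The extremal quantity\<close>

definition spex_lin_class :: "nat \<Rightarrow> nat \<Rightarrow> 'b set set \<Rightarrow> nat set set set" where
  "spex_lin_class r n F =
     {E. uniform_hypergraph n r E \<and> linear_hypergraph E \<and> connected_hypergraph n E \<and> Berge_free F E}"

text \<open>
  For some \<open>n\<close> there is no connected linear \<open>r\<close>-graph on \<open>n\<close> vertices (e.g. \<open>r = 3\<close>, \<open>n = 4\<close>);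
  the maximum over the empty class is taken to be \<open>0\<close>.
\<close>

definition spex_lin :: "nat \<Rightarrow> nat \<Rightarrow> 'b set set \<Rightarrow> real" where
  "spex_lin r n F =
     (if spex_lin_class r n F = {} then 0 else Max (spectral_radius n r ` spex_lin_class r n F))"

lemma finite_spex_lin_class: "finite (spex_lin_class r n F)"
proof (rule finite_subset)
  show "spex_lin_class r n F \<subseteq> Pow (Pow {1..n})"
    by (auto simp: spex_lin_class_def uniform_hypergraph_def)
qed simp

definition f_bound :: "nat \<Rightarrow> nat \<Rightarrow> nat \<Rightarrow> real \<Rightarrow> real \<Rightarrow> real" where
  "f_bound n r t x y =
     (let n = real n; r = real r; t = real t in
      (t * (r - 1) + (r - 2) * (n - r) / (2 * (r - 1)) + (n - r) / (r - 1)\<^sup>2) * x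
      + 1 / (r - 1) * y
      - (t + r - 2 + (r - 2) * (n - r - 2) / (2 * (r - 1))
         - (r - 2) * (r - 3) * (n - r) / (2 * (r - 1)\<^sup>2)))"

end

theory Submission
  imports Defs "HOL-Combinatorics.Multiset_Permutations"
begin

text \<open>
  By linearity, the edges through a vertex are disjoint apart from that vertex, so every degree is
  at most \<open>x = (n - 1) / (r - 1)\<close>.  The eigenvalue equation at an entry of maximal modulus bounds
  the spectral radius by the maximum degree.  Finally \<open>f(n, r, t, x, x) \<ge> x\<^sup>2\<close>: with \<open>d = r - 1\<close>,
  \<open>m = n - r\<close> and \<open>x = 1 + m / d\<close>, the difference is a polynomial in \<open>m\<close> with nonnegative
  coefficients.
\<close>

lemma linear_hypergraph_degree_le:
  assumes uni: "uniform_hypergraph n r E" and lin: "linear_hypergraph E" and i: "i \<in> {1..n}"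
  shows "(r - 1) * card {e \<in> E. i \<in> e} \<le> n - 1"
proof -
  let ?D = "{e \<in> E. i \<in> e}"
  have sub: "e \<subseteq> {1..n}" and card_e: "card e = r" if "e \<in> E" for e
    using uni that by (auto simp: uniform_hypergraph_def)
  have fin_e: "finite e" if "e \<in> E" for e
    using sub[OF that] finite_subset by blast
  have "finite E" using sub by (intro finite_subset[of E "Pow {1..n}"]) auto
  then have finD: "finite ?D" by simp
  have disj: "(e - {i}) \<inter> (e' - {i}) = {}" if e: "e \<in> ?D" "e' \<in> ?D" "e \<noteq> e'" for e e'
  proof (rule ccontr)
    \<comment> \<open>A second common vertex \<open>j\<close> would make two distinct edges share
      the pair \<open>{i, j}\<close>, against linearity.\<close>
    assume "(e - {i}) \<inter> (e' - {i}) \<noteq> {}"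
    then obtain j where j: "j \<in> e" "j \<in> e'" "j \<noteq> i" by blast
    have "card {i, j} \<le> card (e \<inter> e')"
      using e j fin_e by (intro card_mono) auto
    moreover have "card (e \<inter> e') \<le> 1"
      using lin e by (auto simp: linear_hypergraph_def)
    ultimately show False using j by simp
  qed
  \<comment> \<open>Each edge through \<open>i\<close> contributes its \<open>r - 1\<close> other
    vertices, and by \<open>disj\<close> none of them is counted twice.\<close>
  have "(r - 1) * card ?D = (\<Sum>e\<in>?D. card (e - {i}))"
    using card_e by simp
  also have "\<dots> = card (\<Union>e\<in>?D. e - {i})"
    using finD fin_e disj by (intro card_UN_disjoint[symmetric]) auto
  also have "\<dots> \<le> card ({1..n} - {i})"
    using sub by (intro card_mono) auto
  also have "\<dots> = n - 1" using i by simp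
  finally show ?thesis .
qed

text \<open>A list counted here has \<open>r\<close> entries in all and an \<open>r\<close>-element
  range, so it orders the other vertices of one edge through \<open>i\<close>. The factor
  \<open>fact (r - 1)\<close> counts these orderings and cancels the normalisation of the adjacency
  tensor.\<close>

lemma card_index_lists_le:
  assumes uni: "uniform_hypergraph n r E" and "r \<ge> 1"
  shows "card {js. length js = r - 1 \<and> set (i # js) \<in> E} \<le> fact (r - 1) * card {e \<in> E. i \<in> e}"
proof -
  let ?D = "{e \<in> E. i \<in> e}"
  have "E \<subseteq> Pow {1..n}" using uni by (auto simp: uniform_hypergraph_def)
  then have finD: "finite ?D" using finite_subset by fastforce
  have card_e: "card e = r" and fin_e: "finite e" if "e \<in> E" for e
    using uni that by (auto simp: uniform_hypergraph_def intro: finite_subset)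
  have "js \<in> permutations_of_set (set (i # js) - {i})"
    if js: "length js = r - 1" "set (i # js) \<in> E" for js
  proof -
    have "card (set (i # js)) = length (i # js)"
      using card_e[OF js(2)] js(1) \<open>r \<ge> 1\<close> by simp
    then have "distinct (i # js)" by (rule card_distinct)
    then show ?thesis by (auto simp: permutations_of_set_def)
  qed
  then have sub: "{js. length js = r - 1 \<and> set (i # js) \<in> E} \<subseteq> (\<Union>e\<in>?D. permutations_of_set (e - {i}))"
    by fastforce
  have "card {js. length js = r - 1 \<and> set (i # js) \<in> E}
      \<le> card (\<Union>e\<in>?D. permutations_of_set (e - {i}))"
    using finD by (intro card_mono sub) auto
  also have "\<dots> \<le> (\<Sum>e\<in>?D. card (permutations_of_set (e - {i})))"
    using finD by (rule card_UN_le)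
  also have "\<dots> = fact (r - 1) * card ?D"
    using card_e fin_e by (simp add: mult.commute)
  finally show ?thesis .
qed

text \<open>Scale an eigenvector to maximal modulus 1 and take a coordinate \<open>i\<close> of
  modulus 1. There the right side has modulus \<open>cmod \<mu>\<close>, while all products on the
  left have modulus at most 1. The triangle inequality leaves the row sum at \<open>i\<close>, which
  is at most the degree of \<open>i\<close>.\<close>

lemma adjacency_tensor_eigenvalue_le_degree:
  assumes uni: "uniform_hypergraph n r E" and "r \<ge> 1"
    and ev: "tensor_eigenvalue n r (adjacency_tensor r E) \<mu>"
  obtains i where "i \<in> {1..n}" "cmod \<mu> \<le> real (card {e \<in> E. i \<in> e})"
proof -
  let ?J = "{js. length js = r - 1 \<and> set js \<subseteq> {1..n}}"
  obtain x where x: "\<And>i. cmod (x i) \<le> 1" "\<exists>i\<in>{1..n}. cmod (x i) = 1"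
    "\<And>i. i \<in> {1..n} \<Longrightarrow> tensor_apply n r (adjacency_tensor r E) x i = \<mu> * x i ^ (r - 1)"
    using tensor_eigenvalue_normalized[OF ev] by blast
  then obtain i where i: "i \<in> {1..n}" "cmod (x i) = 1" by blast
  \<comment> \<open>Edges lie in \<open>{1..n}\<close>, so the range condition in \<open>?J\<close>
    is automatic.\<close>
  have J: "{js \<in> ?J. set (i # js) \<in> E} = {js. length js = r - 1 \<and> set (i # js) \<in> E}"
    using uni by (auto simp: uniform_hypergraph_def)
  have "cmod \<mu> = cmod (tensor_apply n r (adjacency_tensor r E) x i)"
    using x(3)[OF i(1)] i(2) by (simp add: norm_mult norm_power)
  also have "\<dots> \<le> (\<Sum>js\<in>?J. cmod (adjacency_tensor r E (i # js)))"
    unfolding tensor_apply_def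
    by (rule sum_norm_le) (auto simp: norm_mult intro!: mult_left_le cmod_prod_list_le_1 x(1))
  also have "\<dots> = (\<Sum>js\<in>?J. if set (i # js) \<in> E then 1 / fact (r - 1) else 0)"
    using \<open>r \<ge> 1\<close> by (intro sum.cong) (auto simp: adjacency_tensor_def norm_divide)
  also have "\<dots> = real (card {js \<in> ?J. set (i # js) \<in> E}) / fact (r - 1)"
    by (subst sum.inter_filter[symmetric]) (use finite_index_lists in auto)
  also have "\<dots> \<le> real (fact (r - 1) * card {e \<in> E. i \<in> e}) / fact (r - 1)"
    unfolding J using card_index_lists_le[OF uni \<open>r \<ge> 1\<close>, of i]
    by (intro divide_right_mono) (simp_all only: of_nat_le_iff fact_ge_zero)
  also have "\<dots> = real (card {e \<in> E. i \<in> e})" by simp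
  finally show ?thesis using that i(1) by blast
qed

text \<open>The spectral radius is attained by some eigenvalue, so the degree bound for that
  eigenvalue suffices.\<close>

lemma linear_hypergraph_spectral_radius_le:
  assumes uni: "uniform_hypergraph n r E" and lin: "linear_hypergraph E"
    and "r \<ge> 3" "n \<ge> 1"
  shows "spectral_radius n r E \<le> (real n - 1) / (real r - 1)"
proof -
  obtain \<mu> where \<mu>: "tensor_eigenvalue n r (adjacency_tensor r E) \<mu>" "cmod \<mu> = spectral_radius n r E"
    using spectral_radius_max(1)[OF \<open>r \<ge> 3\<close> \<open>n \<ge> 1\<close> uni] by blast
  obtain i where i: "i \<in> {1..n}" "cmod \<mu> \<le> real (card {e \<in> E. i \<in> e})"
    using adjacency_tensor_eigenvalue_le_degree[OF uni _ \<mu>(1)] \<open>r \<ge> 3\<close> by auto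
  have "real ((r - 1) * card {e \<in> E. i \<in> e}) \<le> real (n - 1)"
    using linear_hypergraph_degree_le[OF uni lin i(1)] by (simp only: of_nat_le_iff)
  then have "real (card {e \<in> E. i \<in> e}) \<le> (real n - 1) / (real r - 1)"
    using \<open>r \<ge> 3\<close> \<open>n \<ge> 1\<close> by (simp add: of_nat_diff pos_le_divide_eq mult.commute)
  with i(2) \<mu>(2) show ?thesis by simp
qed

lemma f_bound_ge_square:
  assumes "n \<ge> r" "r \<ge> 3" "t \<ge> 1"
  defines "x \<equiv> (real n - 1) / (real r - 1)"
  shows "x\<^sup>2 \<le> f_bound n r t x x"
proof -
  define d where "d = real r - 1"
  define m where "m = real n - real r"
  define T where "T = real t"
  have d: "d \<ge> 2" and m: "m \<ge> 0" and T: "T \<ge> 1"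
    using assms by (auto simp: d_def m_def T_def)
  have r: "real r = d + 1" and n: "real n = m + d + 1" by (auto simp: d_def m_def)
  have x: "x = 1 + m / d" using d by (simp add: x_def r n field_simps)
  \<comment> \<open>The difference is grouped so that signs can be read off: \<open>T - 1\<close> is
    nonnegative by \<open>t \<ge> 1\<close>, and \<open>d - 2\<close> by
    \<open>r \<ge> 3\<close>.\<close>
  have "f_bound n r t x x - x\<^sup>2 = (T - 1) * (d - 1) + (T - 1 + ((d - 1) / d)\<^sup>2 + 1 / d\<^sup>2) * m
      + (d - 1) * (d - 2) / (2 * d\<^sup>2) * m * x"
    unfolding f_bound_def Let_def x r n T_def[symmetric] using d
    by (simp add: divide_simps power2_eq_square) algebra
  also have "\<dots> \<ge> 0"
    using d m T by (intro add_nonneg_nonneg mult_nonneg_nonneg divide_nonneg_nonneg)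
      (auto simp: x)
  finally show ?thesis by simp
qed

theorem theorem1p2:
  fixes n r t :: nat
  assumes "n \<ge> r" and "r \<ge> 3" and "t \<ge> 3"
  shows "spex_lin r n (complete_bipartite 3 t)
           \<le> sqrt (f_bound n r t ((real n - 1) / (real r - 1)) ((real n - 1) / (real r - 1)))"
proof -
  let ?x = "(real n - 1) / (real r - 1)"
  let ?C = "spex_lin_class r n (complete_bipartite 3 t)"
  \<comment> \<open>This settles the empty class, where \<open>spex_lin\<close> is 0 by
    convention.\<close>
  have "0 \<le> ?x" using assms by simp
  moreover have "Max (spectral_radius n r ` ?C) \<le> ?x" if "?C \<noteq> {}"
    using that finite_spex_lin_class assms
    by (subst Max_le_iff) (auto simp: spex_lin_class_def intro!: linear_hypergraph_spectral_radius_le)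
  ultimately have "spex_lin r n (complete_bipartite 3 t) \<le> ?x"
    by (simp add: spex_lin_def)
  also have "?x \<le> sqrt (f_bound n r t ?x ?x)"
    using f_bound_ge_square[of r n t] assms by (intro real_le_rsqrt) auto
  finally show ?thesis .
qed

end
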